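(* Let $\mathbb{F}$ be a field, let $(\mathcal{V}, \langle \cdot , \cdot \rangle)$ be a pre-euclidean space over $\mathbb{F}$, let $f:\mathcal{V}\to\mathcal{V}$ be a linear operator, and let $\mathcal{B}=\{v_i\}_{i\in I}$ and $\mathcal{B}'=\{v'_j\}_{j\in J}$ be two bases of $\mathcal{V}$. Let $\Gamma(f,\mathcal{B})=(V,E)$ and $\Gamma(f,\mathcal{B}')=(V',E')$ be the associated graphs. Consider the following assertions. (i) The bases $\mathcal{B}$ and $\mathcal{B}'$ are $f$-equivalent. (ii) The graphs $\Gamma(f,\mathcal{B})$ and $\Gamma(f,\mathcal{B}')$ are isomorphic. (iii) The decomposition induced by $\mathcal{B}$, $$\Upsilon:\ \mathcal{V}=\bigoplus_{[v]\in V/\sim}\mathcal{V}_{[v]}\ \text{(orthogonal direct sum)},\qquad f=\sum_{[v]\in V/\sim} f_{[v]},$$ where each $f_{[v]}:\mathcal{V}\to\mathcal{V}$ is the linear operator with $f_{[v]}|_{\mathcal{V}_{[v]}}=f|_{\mathcal{V}_{[v]}}$, $f_{[v]}(\mathcal{V}_{[v]})\subset\mathcal{V}_{[v]}$ and $f_{[v]}(\mathcal{V}_{[w]})=\{0\}$ for $[w]\neq[v]$, and the decomposition induced by $\mathcal{B}'$, $$\Upsilon':\ \mathcal{V}=\bigoplus_{[v']\in V'/\sim}\mathcal{V}'_{[v']}\ \text{(orthogonal direct sum)},\qquad f=\sum_{[v']\in V'/\sim} f'_{[v']},$$ where each $f'_{[v']}:\mathcal{V}\to\mathcal{V}$ is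 the linear operator with $f'_{[v']}|_{\mathcal{V}'_{[v']}}=f|_{\mathcal{V}'_{[v']}}$, $f'_{[v']}(\mathcal{V}'_{[v']})\subset\mathcal{V}'_{[v']}$ and $f'_{[v']}(\mathcal{V}'_{[w']})=\{0\}$ for $[w']\neq[v']$, are equivalent (i.e. $\Upsilon$ and $\Upsilon'$ are equivalent). Then (i) implies (ii) and (iii).
   Context: Vector spaces are over an arbitrary field $\mathbb{F}$ and of arbitrary (possibly infinite) dimension. A pre-euclidean space is a pair $(\mathcal{V}, \langle\cdot,\cdot\rangle)$ where $\mathcal{V}$ is an $\mathbb{F}$-vector space and $\langle\cdot,\cdot\rangle:\mathcal{V}\times\mathcal{V}\to\mathbb{F}$ is a bilinear form (no symmetry or non-degeneracy is assumed). An automorphism of $\mathcal{V}$ is a bijective linear map $\phi:\mathcal{V}\to\mathcal{V}$ with $\langle\phi(x),\phi(y)\rangle=\langle x,y\rangle$ for all $x,y\in\mathcal{V}$. Orthogonal direct sum: $\mathcal{V}=\bigoplus_{k}U_k$ is an orthogonal direct sum if it is a direct sum of linear subspaces with $\langle u,w\rangle=0$ for all $u\in U_k$, $w\in U_l$ whenever $k\neq l$. Associated graph: for a basis $\mathcal{B}=\{e_i\}$, $\Gamma(f,\mathcal{B})=(V,E)$ is the directed graph with vertex set $V=\mathcal{B}$ and with $(e_i,e_j)\in E$ if and only if $\langle e_i,e_j\rangle\neq 0$, or $\langle e_j,e_i\rangle\neq 0$, or the coefficient of $e_j$ in the expansion of $f(e_i)$ in the basis $\mathcal{B}$ is non-zero.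 Connected vertices: an undirected path from $v$ to $w$ is a finite sequence of vertices $(v_{1},\dots,v_{n})$ with $v_1=v$, $v_n=w$ and, for each $1\le r\le n-1$, $(v_r,v_{r+1})\in E$ or $(v_{r+1},v_r)\in E$. One writes $v\sim w$ if $v=w$ or there is an undirected path from $v$ to $w$; this is an equivalence relation with classes $[v]$. $\mathcal{V}_{[v]}$ denotes the linear span of the class $[v]\subset\mathcal{B}$ (computed in $\Gamma(f,\mathcal{B})$), and $\mathcal{V}'_{[v']}$ the linear span of the class $[v']\subset\mathcal{B}'$ (computed in $\Gamma(f,\mathcal{B}')$). For any basis, these spans always give an orthogonal direct sum decomposition of $\mathcal{V}$ into $f$-invariant subspaces, so the operators in (iii) are well defined; sums of operators are understood pointwise. Graphs $(V,E)$ and $(V',E')$ are isomorphic if there is a bijection $\psi:V\to V'$ such that $(v,w)\in E$ if and only if $(\psi(v),\psi(w))\in E'$. Two bases $\mathcal{B},\mathcal{B}'$ of $\mathcal{V}$ are $f$-equivalent if there is an automorphism $\phi$ of $\mathcal{V}$ with $\phi(\mathcal{B})=\mathcal{B}'$ and $\phi\circ f=f\circ\phi$. Two orthogonal direct sum decompositions $\mathcal{V}=\bigoplus_{i\in I}\mathcal{V}_i$ and $\mathcal{V}=\bigoplus_{j\in J}\mathcal{V}'_j$ are equivalent if there exist an automorphism $\phi$ of $\mathcal{V}$ and a bijection $\sigma:I\to J$ with $\phi(\mathcal{V}_i)=\mathcal{V}'_{\sigma(i)}$ for all $i\in I$. *)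

theory Defs
  imports Complex_Main
begin

section \<open>Directed graphs\<close>

text \<open>A directed graph is a pair of a vertex set and a set of ordered pairs of vertices;
  loops are allowed and the vertex set may be infinite.\<close>

type_synonym 'v graph = "'v set \<times> ('v \<times> 'v) set"

definition undirected_path :: "'v graph \<Rightarrow> 'v list \<Rightarrow> 'v \<Rightarrow> 'v \<Rightarrow> bool" where
  "undirected_path G p v w \<longleftrightarrow>
     p \<noteq> [] \<and> set p \<subseteq> fst G \<and> hd p = v \<and> last p = w \<and>
     successively (\<lambda>a b. (a, b) \<in> snd G \<or> (b, a) \<in> snd G) p"

definition connection_rel :: "'v graph \<Rightarrow> ('v \<times> 'v) set" where
  "connection_rel G =
     {(v, w). v \<in> fst G \<and> w \<in> fst G \<and> (v = w \<or> (\<exists>p. undirected_path G p v w))}"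

definition graph_isomorphic :: "'v graph \<Rightarrow> 'w graph \<Rightarrow> bool" where
  "graph_isomorphic G H \<longleftrightarrow>
     (\<exists>\<psi>. bij_betw \<psi> (fst G) (fst H) \<and>
          (\<forall>v\<in>fst G. \<forall>w\<in>fst G. (v, w) \<in> snd G \<longleftrightarrow> (\<psi> v, \<psi> w) \<in> snd H))"


section \<open>Pre-euclidean spaces\<close>

locale pre_euclidean_space = vector_space scale
  for scale :: "'a::field \<Rightarrow> 'b::ab_group_add \<Rightarrow> 'b" (infixr \<open>*s\<close> 75) +
  fixes form :: "'b \<Rightarrow> 'b \<Rightarrow> 'a"
  assumes form_linear_left: "Vector_Spaces.linear scale (*) (\<lambda>x. form x y)"
    and form_linear_right: "Vector_Spaces.linear scale (*) (\<lambda>y. form x y)"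
begin

definition is_basis :: "'b set \<Rightarrow> bool" where
  "is_basis B \<longleftrightarrow> independent B \<and> span B = UNIV"

definition automorphism :: "('b \<Rightarrow> 'b) \<Rightarrow> bool" where
  "automorphism \<phi> \<longleftrightarrow>
     Vector_Spaces.linear scale scale \<phi> \<and> bij \<phi> \<and> (\<forall>x y. form (\<phi> x) (\<phi> y) = form x y)"

definition f_equivalent :: "('b \<Rightarrow> 'b) \<Rightarrow> 'b set \<Rightarrow> 'b set \<Rightarrow> bool" where
  "f_equivalent f B B' \<longleftrightarrow> (\<exists>\<phi>. automorphism \<phi> \<and> \<phi> ` B = B' \<and> \<phi> \<circ> f = f \<circ> \<phi>)"

definition associated_graph :: "('b \<Rightarrow> 'b) \<Rightarrow> 'b set \<Rightarrow> 'b graph" where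
  "associated_graph f B =
     (B, {(v, w). v \<in> B \<and> w \<in> B \<and>
            (form v w \<noteq> 0 \<or> form w v \<noteq> 0 \<or> representation B (f v) w \<noteq> 0)})"


subsection \<open>Orthogonal direct sum decompositions\<close>

definition direct_sum :: "'k set \<Rightarrow> ('k \<Rightarrow> 'b set) \<Rightarrow> bool" where
  "direct_sum K U \<longleftrightarrow>
     (\<forall>k\<in>K. subspace (U k)) \<and>
     (\<forall>x. \<exists>!u. (\<forall>k\<in>K. u k \<in> U k) \<and> (\<forall>k. k \<notin> K \<longrightarrow> u k = 0) \<and>
               finite {k. u k \<noteq> 0} \<and> x = (\<Sum>k | u k \<noteq> 0. u k))"

definition orthogonal_direct_sum :: "'k set \<Rightarrow> ('k \<Rightarrow> 'b set) \<Rightarrow> bool" where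
  "orthogonal_direct_sum K U \<longleftrightarrow>
     direct_sum K U \<and>
     (\<forall>k\<in>K. \<forall>l\<in>K. k \<noteq> l \<longrightarrow> (\<forall>u\<in>U k. \<forall>w\<in>U l. form u w = 0))"

definition equivalent_decompositions ::
    "'k set \<Rightarrow> ('k \<Rightarrow> 'b set) \<Rightarrow> 'l set \<Rightarrow> ('l \<Rightarrow> 'b set) \<Rightarrow> bool" where
  "equivalent_decompositions I U J W \<longleftrightarrow>
     orthogonal_direct_sum I U \<and> orthogonal_direct_sum J W \<and>
     (\<exists>\<phi> \<sigma>. automorphism \<phi> \<and> bij_betw \<sigma> I J \<and> (\<forall>i\<in>I. \<phi> ` U i = W (\<sigma> i)))"


subsection \<open>The decomposition induced by a basis\<close>

definition classes :: "('b \<Rightarrow> 'b) \<Rightarrow> 'b set \<Rightarrow> 'b set set" where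
  "classes f B = B // connection_rel (associated_graph f B)"

definition is_class_operator :: "('b \<Rightarrow> 'b) \<Rightarrow> 'b set \<Rightarrow> 'b set \<Rightarrow> ('b \<Rightarrow> 'b) \<Rightarrow> bool" where
  "is_class_operator f B C g \<longleftrightarrow>
     Vector_Spaces.linear scale scale g \<and>
     (\<forall>x\<in>span C. g x = f x) \<and>
     g ` span C \<subseteq> span C \<and>
     (\<forall>D\<in>classes f B. D \<noteq> C \<longrightarrow> g ` span D = {0})"

definition class_operator :: "('b \<Rightarrow> 'b) \<Rightarrow> 'b set \<Rightarrow> 'b set \<Rightarrow> 'b \<Rightarrow> 'b" where
  "class_operator f B C = (THE g. is_class_operator f B C g)"

text \<open>The sum of the class operators is taken pointwise and may range over infinitely many
  classes, so it includes the claim that only finitely many summands are non-zero at each vector.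
  The unique existence clause is what gives the definite description above its meaning.\<close>

definition operator_splits :: "('b \<Rightarrow> 'b) \<Rightarrow> 'b set \<Rightarrow> bool" where
  "operator_splits f B \<longleftrightarrow>
     (\<forall>C\<in>classes f B. \<exists>!g. is_class_operator f B C g) \<and>
     (\<forall>x. finite {C \<in> classes f B. class_operator f B C x \<noteq> 0} \<and>
          f x = (\<Sum>C | C \<in> classes f B \<and> class_operator f B C x \<noteq> 0. class_operator f B C x))"

text \<open>The orthogonality and directness of both sums are part of
  \<^const>\<open>equivalent_decompositions\<close>.\<close>

definition induced_decompositions_equivalent :: "('b \<Rightarrow> 'b) \<Rightarrow> 'b set \<Rightarrow> 'b set \<Rightarrow> bool" where
  "induced_decompositions_equivalent f B B' \<longleftrightarrow>
     operator_splits f B \<and> operator_splits f B' \<and>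
     equivalent_decompositions (classes f B) span (classes f B') span"

end

end

(* An automorphism carrying one basis onto the other and commuting with f preserves the form and the
   matrix of f, so it is an isomorphism of the associated graphs. It therefore permutes connected
   components and carries the span of each component onto the span of its image. That each basis
   induces an orthogonal splitting at all follows from the linear projections that keep one
   component of the basis and kill the others: f preserves the span of a component, and the class
   operator of a component is f composed with its projection. *)

theory Submission
  imports Defs "HOL-Library.Disjoint_Sets"
begin

section \<open>Undirected paths and connection classes under graph maps\<close>

lemma undirected_path_rev: "undirected_path G p v w \<Longrightarrow> undirected_path G (rev p) w v"
  by (auto simp: undirected_path_def hd_rev last_rev elim: successively_mono)

text \<open>The head of \<open>q\<close> repeats the last vertex of \<open>p\<close>. Keeping it
  would demand a loop at \<open>v\<close>, so only \<open>tl q\<close> is appended.\<close>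

lemma undirected_path_append:
  assumes "undirected_path G p u v" and "undirected_path G q v w"
  shows "undirected_path G (p @ tl q) u w"
proof (cases "tl q")
  case Nil
  then have "q = [v]"
    using assms(2) by (cases q) (auto simp: undirected_path_def)
  then show ?thesis
    using assms by (auto simp: undirected_path_def)
next
  case (Cons a r)
  then have "q = v # a # r"
    using assms(2) by (cases q) (auto simp: undirected_path_def)
  then show ?thesis
    using assms by (auto simp: undirected_path_def successively_append_iff)
qed

lemma undirected_path_map:
  assumes "undirected_path G p v w" and "\<psi> ` fst G \<subseteq> fst H"
    and "\<And>a b. a \<in> fst G \<Longrightarrow> b \<in> fst G \<Longrightarrow> (a, b) \<in> snd G \<Longrightarrow> (\<psi> a, \<psi> b) \<in> snd H"
  shows "undirected_path H (map \<psi> p) (\<psi> v) (\<psi> w)"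
proof -
  have p: "p \<noteq> []" "set p \<subseteq> fst G" "hd p = v" "last p = w"
      "successively (\<lambda>a b. (a, b) \<in> snd G \<or> (b, a) \<in> snd G) p"
    using assms(1) by (auto simp: undirected_path_def)
  have "successively (\<lambda>a b. (\<psi> a, \<psi> b) \<in> snd H \<or> (\<psi> b, \<psi> a) \<in> snd H) p"
    using p(5) by (rule successively_mono) (use p(2) assms(3) in blast)
  then show ?thesis
    using p assms(2) by (auto simp: undirected_path_def successively_map hd_map last_map)
qed

lemma equiv_connection_rel: "equiv (fst G) (connection_rel G)"
proof (rule equivI)
  show "connection_rel G \<subseteq> fst G \<times> fst G" and "refl_on (fst G) (connection_rel G)"
    by (auto simp: connection_rel_def refl_on_def)
  show "sym (connection_rel G)"
    unfolding connection_rel_def by (rule symI) (blast intro: undirected_path_rev)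
  show "trans (connection_rel G)"
    unfolding connection_rel_def by (rule transI) (blast intro: undirected_path_append)
qed

lemma edge_in_connection_rel:
  assumes "v \<in> fst G" "w \<in> fst G" "(v, w) \<in> snd G \<or> (w, v) \<in> snd G"
  shows "(v, w) \<in> connection_rel G"
proof -
  have "undirected_path G [v, w] v w"
    using assms by (simp add: undirected_path_def)
  then show ?thesis
    using assms by (auto simp: connection_rel_def)
qed

text \<open>Edges need only be preserved in one direction, so the lemma applies to a graph
  isomorphism and to its inverse alike.\<close>

lemma connection_rel_map:
  assumes "(v, w) \<in> connection_rel G" and "\<psi> ` fst G \<subseteq> fst H"
    and "\<And>a b. a \<in> fst G \<Longrightarrow> b \<in> fst G \<Longrightarrow> (a, b) \<in> snd G \<Longrightarrow> (\<psi> a, \<psi> b) \<in> snd H"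
  shows "(\<psi> v, \<psi> w) \<in> connection_rel H"
proof -
  have "v \<in> fst G" "w \<in> fst G" "v = w \<or> (\<exists>p. undirected_path G p v w)"
    using assms(1) by (auto simp: connection_rel_def)
  moreover have "\<exists>q. undirected_path H q (\<psi> v) (\<psi> w)" if "undirected_path G p v w" for p
    using undirected_path_map[OF that assms(2,3)] by blast
  ultimately show ?thesis
    using assms(2) unfolding connection_rel_def by blast
qed

lemma connection_rel_iso_iff:
  assumes bij: "bij_betw \<psi> (fst G) (fst H)"
    and edge: "\<And>a b. a \<in> fst G \<Longrightarrow> b \<in> fst G \<Longrightarrow> (a, b) \<in> snd G \<longleftrightarrow> (\<psi> a, \<psi> b) \<in> snd H"
    and v: "v \<in> fst G" and w: "w \<in> fst G"
  shows "(\<psi> v, \<psi> w) \<in> connection_rel H \<longleftrightarrow> (v, w) \<in> connection_rel G"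
proof
  assume "(v, w) \<in> connection_rel G"
  then show "(\<psi> v, \<psi> w) \<in> connection_rel H"
    by (rule connection_rel_map) (use edge bij_betw_imp_surj_on[OF bij] in blast)+
next
  \<comment> \<open>For the converse the path is transported back along the inverse bijection, which
    preserves edges because \<open>edge\<close> is an equivalence.\<close>
  let ?\<chi> = "inv_into (fst G) \<psi>"
  assume "(\<psi> v, \<psi> w) \<in> connection_rel H"
  then have "(?\<chi> (\<psi> v), ?\<chi> (\<psi> w)) \<in> connection_rel G"
  proof (rule connection_rel_map)
    show "?\<chi> ` fst H \<subseteq> fst G"
      using bij_betw_imp_surj_on[OF bij_betw_inv_into[OF bij]] by simp
    show "(?\<chi> a, ?\<chi> b) \<in> snd G" if "a \<in> fst H" "b \<in> fst H" "(a, b) \<in> snd H" for a b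
    proof -
      have "?\<chi> a \<in> fst G" "?\<chi> b \<in> fst G"
        using that(1,2) bij_betw_apply[OF bij_betw_inv_into[OF bij]] by blast+
      then show ?thesis
        using that edge by (simp add: bij_betw_inv_into_right[OF bij])
    qed
  qed
  then show "(v, w) \<in> connection_rel G"
    using bij v w by (simp add: bij_betw_inv_into_left)
qed

text \<open>A vertex related to \<open>\<psi> v\<close> lies in \<open>fst H\<close>, so it has a
  preimage in \<open>fst G\<close>, and \<open>connection_rel_iso_iff\<close> moves the relation
  back to \<open>G\<close>.\<close>

lemma connection_class_iso:
  assumes bij: "bij_betw \<psi> (fst G) (fst H)"
    and edge: "\<And>a b. a \<in> fst G \<Longrightarrow> b \<in> fst G \<Longrightarrow> (a, b) \<in> snd G \<longleftrightarrow> (\<psi> a, \<psi> b) \<in> snd H"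
    and v: "v \<in> fst G"
  shows "connection_rel H `` {\<psi> v} = \<psi> ` (connection_rel G `` {v})"
proof
  show "connection_rel H `` {\<psi> v} \<subseteq> \<psi> ` (connection_rel G `` {v})"
  proof
    fix y assume y: "y \<in> connection_rel H `` {\<psi> v}"
    then have "y \<in> fst H" by (auto simp: connection_rel_def)
    then obtain w where "w \<in> fst G" "y = \<psi> w"
      using bij by (auto simp: bij_betw_def)
    then show "y \<in> \<psi> ` (connection_rel G `` {v})"
      using y connection_rel_iso_iff[OF bij edge v] by auto
  qed
  show "\<psi> ` (connection_rel G `` {v}) \<subseteq> connection_rel H `` {\<psi> v}"
    using connection_rel_iso_iff[OF bij edge v] by (auto simp: connection_rel_def)
qed

lemma bij_betw_connection_classes:
  assumes bij: "bij_betw \<psi> (fst G) (fst H)"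
    and edge: "\<And>a b. a \<in> fst G \<Longrightarrow> b \<in> fst G \<Longrightarrow> (a, b) \<in> snd G \<longleftrightarrow> (\<psi> a, \<psi> b) \<in> snd H"
  shows "bij_betw ((`) \<psi>) (fst G // connection_rel G) (fst H // connection_rel H)"
proof -
  \<comment> \<open>Classes are subsets of \<open>fst G\<close>, so it suffices that taking images
    is injective on the power set.\<close>
  have "inj_on ((`) \<psi>) (Pow (fst G))"
    using bij by (simp add: bij_betw_def inj_on_image_Pow)
  moreover have "fst G // connection_rel G \<subseteq> Pow (fst G)"
    by (auto simp: quotient_def connection_rel_def)
  ultimately have "inj_on ((`) \<psi>) (fst G // connection_rel G)"
    by (rule inj_on_subset)
  moreover have "(`) \<psi> ` (fst G // connection_rel G) = fst H // connection_rel H"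
  proof -
    have "(`) \<psi> ` (fst G // connection_rel G)
        = (\<lambda>v. \<psi> ` (connection_rel G `` {v})) ` fst G"
      by (auto simp: quotient_def)
    also have "\<dots> = (\<lambda>v. connection_rel H `` {\<psi> v}) ` fst G"
      by (rule image_cong) (simp_all add: connection_class_iso[OF bij edge])
    also have "\<dots> = (\<lambda>y. connection_rel H `` {y}) ` fst H"
      unfolding bij_betw_imp_surj_on[OF bij, symmetric] image_image by (rule refl)
    also have "\<dots> = fst H // connection_rel H"
      by (auto simp: quotient_def)
    finally show ?thesis .
  qed
  ultimately show ?thesis
    by (simp add: bij_betw_def)
qed

section \<open>Projections attached to subsets of a basis\<close>

context pre_euclidean_space
begin

interpretation self: vector_space_pair scale scale
  by unfold_locales

text \<open>The field is viewed as a vector space over itself, so that fixing one argument of the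
  form leaves a linear map to which facts about spans apply.\<close>

interpretation functional: vector_space_pair scale "(*)"
  by unfold_locales (simp_all add: algebra_simps)

lemma basis_linear_eq:
  assumes "is_basis B" "Vector_Spaces.linear scale scale g" "Vector_Spaces.linear scale scale h"
    and "\<And>b. b \<in> B \<Longrightarrow> g b = h b"
  shows "g = h"
proof
  show "g x = h x" for x
    by (rule self.linear_eq_on[OF assms(2,3) _ assms(4), where B = B])
      (use assms(1) in \<open>auto simp: is_basis_def\<close>)
qed

text \<open>For a basis \<open>B\<close> and \<open>C \<subseteq> B\<close> this is the projection
  onto \<open>span C\<close> along \<open>span (B - C)\<close>. Prescribing it on basis vectors lets
  later identities be checked there.\<close>

definition basis_projection :: "'b set \<Rightarrow> 'b set \<Rightarrow> 'b \<Rightarrow> 'b" where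
  "basis_projection B C = self.construct B (\<lambda>b. if b \<in> C then b else 0)"

lemma linear_basis_projection:
  "is_basis B \<Longrightarrow> Vector_Spaces.linear scale scale (basis_projection B C)"
  by (simp add: basis_projection_def is_basis_def self.linear_construct)

lemma basis_projection_basis:
  "is_basis B \<Longrightarrow> b \<in> B \<Longrightarrow> basis_projection B C b = (if b \<in> C then b else 0)"
  by (simp add: basis_projection_def is_basis_def self.construct_basis)

lemma basis_projection_in_span:
  assumes "is_basis B"
  shows "basis_projection B C x \<in> span C"
proof -
  have "basis_projection B C x \<in> span ((\<lambda>b. if b \<in> C then b else 0) ` B)"
    unfolding basis_projection_def using assms
    by (intro self.construct_in_span) (simp add: is_basis_def)
  moreover have "span ((\<lambda>b. if b \<in> C then b else 0) ` B) \<subseteq> span C"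
    by (rule span_minimal) (auto intro: span_base span_zero)
  ultimately show ?thesis by blast
qed

lemma basis_projection_ident:
  assumes "is_basis B" "C \<subseteq> B" "x \<in> span C"
  shows "basis_projection B C x = x"
proof (rule self.linear_eq_on[OF linear_basis_projection[OF assms(1)] linear_ident assms(3)])
  show "basis_projection B C b = b" if "b \<in> C" for b
    using that assms(2) by (auto simp: basis_projection_basis[OF assms(1)])
qed

lemma basis_projection_eq_0:
  assumes "is_basis B" "D \<subseteq> B" "C \<inter> D = {}" "x \<in> span D"
  shows "basis_projection B C x = 0"
proof (rule self.linear_eq_0_on_span[OF linear_basis_projection[OF assms(1)] _ assms(4)])
  show "basis_projection B C b = 0" if "b \<in> D" for b
  proof -
    have "b \<in> B" "b \<notin> C" using that assms(2,3) by auto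
    then show ?thesis by (simp add: basis_projection_basis[OF assms(1)])
  qed
qed

text \<open>A vector involves finitely many basis vectors, each in exactly one block of the
  partition. Only the blocks met contribute, and their projections together restore every basis
  vector involved.\<close>

lemma sum_basis_projections:
  assumes basis: "is_basis B" and cover: "\<Union>P = B" and disj: "disjoint P"
  shows "finite {C \<in> P. basis_projection B C x \<noteq> 0}"
    and "(\<Sum>C | C \<in> P \<and> basis_projection B C x \<noteq> 0. basis_projection B C x) = x"
proof -
  have "x \<in> span B"
    using basis by (simp add: is_basis_def)
  then obtain S r where S: "finite S" "S \<subseteq> B" "x = (\<Sum>a\<in>S. r a *s a)"
    unfolding span_explicit by blast
  then have x: "x \<in> span S"
    by (auto intro: span_sum span_scale span_base)
  define K where "K = {C \<in> P. C \<inter> S \<noteq> {}}"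
  have one: "\<exists>!C. C \<in> P \<and> b \<in> C" if "b \<in> B" for b
    using that cover disj by (auto simp: disjoint_def)
  \<comment> \<open>Sending a basis vector to its unique block exhibits \<open>K\<close> as part of
    an image of the finite set \<open>S\<close>.\<close>
  have "K \<subseteq> (\<lambda>b. THE C. C \<in> P \<and> b \<in> C) ` S"
  proof
    fix C assume "C \<in> K"
    then obtain b where b: "C \<in> P" "b \<in> C" "b \<in> S" by (auto simp: K_def)
    then have "C = (THE C. C \<in> P \<and> b \<in> C)"
      using the1_equality[OF one[of b], of C] S(2) by auto
    then show "C \<in> (\<lambda>b. THE C. C \<in> P \<and> b \<in> C) ` S" using b by blast
  qed
  then have K: "finite K"
    using S(1) finite_surj by blast
  have sub: "{C \<in> P. basis_projection B C x \<noteq> 0} \<subseteq> K"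
    using basis_projection_eq_0[OF basis S(2) _ x] by (auto simp: K_def)
  then show "finite {C \<in> P. basis_projection B C x \<noteq> 0}"
    using K finite_subset by blast
  \<comment> \<open>The index set on the left varies with \<open>x\<close>. Summing over the fixed
    finite set \<open>K\<close> instead gives a linear map, which can be compared with the identity
    on \<open>S\<close>.\<close>
  have "(\<Sum>C | C \<in> P \<and> basis_projection B C x \<noteq> 0. basis_projection B C x)
      = (\<Sum>C\<in>K. basis_projection B C x)"
    using K sub by (intro sum.mono_neutral_left) (auto simp: K_def)
  also have "\<dots> = x"
  proof (rule self.linear_eq_on[OF _ _ x, where g = "\<lambda>x. x"])
    show "Vector_Spaces.linear scale scale (\<lambda>x. \<Sum>C\<in>K. basis_projection B C x)"
      using linear_basis_projection[OF basis] by (intro self.linear_compose_sum) auto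
    show "Vector_Spaces.linear scale scale (\<lambda>x. x)"
      by (rule linear_ident)
    fix b assume b: "b \<in> S"
    then obtain C where C: "C \<in> P" "b \<in> C" using S(2) cover by blast
    have "(\<Sum>C\<in>K. basis_projection B C b) = (\<Sum>D\<in>K. if D = C then b else 0)"
    proof (rule sum.cong[OF refl])
      fix D assume "D \<in> K"
      then have "b \<in> D \<longleftrightarrow> D = C"
        using b C S(2) one[of b] by (auto simp: K_def)
      then show "basis_projection B D b = (if D = C then b else 0)"
        using b S(2) by (auto simp: basis_projection_basis[OF basis])
    qed
    then show "(\<Sum>C\<in>K. basis_projection B C b) = b"
      using K C b by (auto simp: K_def)
  qed
  finally show "(\<Sum>C | C \<in> P \<and> basis_projection B C x \<noteq> 0. basis_projection B C x) = x" .
qed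

lemma direct_sum_basis_partition:
  assumes basis: "is_basis B" and cover: "\<Union>P = B" and disj: "disjoint P"
  shows "direct_sum P span"
  unfolding direct_sum_def
proof (intro conjI ballI allI)
  fix x
  \<comment> \<open>The value 0 outside \<open>P\<close> is imposed by \<open>direct_sum\<close>,
    where uniqueness concerns functions on the whole index type.\<close>
  let ?u = "\<lambda>C. if C \<in> P then basis_projection B C x else 0"
  have u: "{C. ?u C \<noteq> 0} = {C. C \<in> P \<and> basis_projection B C x \<noteq> 0}"
    by auto
  show "\<exists>!u. (\<forall>C\<in>P. u C \<in> span C) \<and> (\<forall>C. C \<notin> P \<longrightarrow> u C = 0) \<and>
      finite {C. u C \<noteq> 0} \<and> x = (\<Sum>C | u C \<noteq> 0. u C)"
  proof (rule ex1I[of _ ?u])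
    have "(\<Sum>C | ?u C \<noteq> 0. ?u C)
        = (\<Sum>C | C \<in> P \<and> basis_projection B C x \<noteq> 0. basis_projection B C x)"
      unfolding u by (rule sum.cong) auto
    then show "(\<forall>C\<in>P. ?u C \<in> span C) \<and> (\<forall>C. C \<notin> P \<longrightarrow> ?u C = 0) \<and>
        finite {C. ?u C \<noteq> 0} \<and> x = (\<Sum>C | ?u C \<noteq> 0. ?u C)"
      using sum_basis_projections[OF assms, of x]
      by (simp add: u basis_projection_in_span[OF basis])
  next
    fix u assume "(\<forall>C\<in>P. u C \<in> span C) \<and> (\<forall>C. C \<notin> P \<longrightarrow> u C = 0) \<and>
      finite {C. u C \<noteq> 0} \<and> x = (\<Sum>C | u C \<noteq> 0. u C)"
    then have v: "\<And>C. C \<in> P \<Longrightarrow> u C \<in> span C" "\<And>C. C \<notin> P \<Longrightarrow> u C = 0"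
      "finite {C. u C \<noteq> 0}" "x = (\<Sum>C | u C \<noteq> 0. u C)" by auto
    \<comment> \<open>Projecting any decomposition of \<open>x\<close> to block \<open>C\<close>
      kills all components but \<open>u C\<close>, so the components are determined by
      \<open>x\<close>.\<close>
    have "basis_projection B C x = u C" if C: "C \<in> P" for C
    proof -
      have "basis_projection B C x = (\<Sum>D | u D \<noteq> 0. basis_projection B C (u D))"
        unfolding v(4) by (rule self.linear_sum[OF linear_basis_projection[OF basis]])
      also have "\<dots> = (\<Sum>D | u D \<noteq> 0. if D = C then u C else 0)"
      proof (rule sum.cong[OF refl])
        fix D assume "D \<in> {D. u D \<noteq> 0}"
        then have D: "D \<in> P" "D \<subseteq> B" "u D \<in> span D"
          using v(1,2) cover by auto
        show "basis_projection B C (u D) = (if D = C then u C else 0)"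
          using D C disj basis_projection_ident[OF basis D(2,3)]
            basis_projection_eq_0[OF basis D(2) _ D(3), of C]
          by (auto simp: disjoint_def)
      qed
      also have "\<dots> = u C"
        using v(3) by auto
      finally show ?thesis .
    qed
    then show "u = ?u"
      using v(2) by auto
  qed
qed simp

section \<open>Connection classes: orthogonality and invariance of their spans\<close>

lemma form_span_eq_0:
  assumes "\<And>c d. c \<in> C \<Longrightarrow> d \<in> D \<Longrightarrow> form c d = 0" and "u \<in> span C" "w \<in> span D"
  shows "form u w = 0"
proof -
  have "form c w = 0" if "c \<in> C" for c
    using functional.linear_eq_0_on_span[OF form_linear_right _ assms(3)] assms(1) that by blast
  then show ?thesis
    using functional.linear_eq_0_on_span[OF form_linear_left _ assms(2)] by blast
qed

lemma fst_associated_graph: "fst (associated_graph f B) = B"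
  by (simp add: associated_graph_def)

lemma equiv_classes: "equiv B (connection_rel (associated_graph f B))"
  using equiv_connection_rel[of "associated_graph f B"] by (simp add: fst_associated_graph)

lemma Union_classes: "\<Union>(classes f B) = B"
  unfolding classes_def by (rule Union_quotient[OF equiv_classes])

lemma disjoint_classes: "disjoint (classes f B)"
  using quotient_disj[OF equiv_classes[of B f]] by (auto simp: classes_def disjoint_def)

text \<open>Edges record non-zero pairings and non-zero coefficients of \<open>f\<close>. Their
  confinement to a class therefore yields both orthogonality and invariance of the spans.\<close>

lemma edge_same_class:
  assumes "C \<in> classes f B" "v \<in> C" "w \<in> B"
    and "(v, w) \<in> snd (associated_graph f B)"
  shows "w \<in> C"
proof -
  have "v \<in> B" using assms(1,2) Union_classes by blast
  then have "(v, w) \<in> connection_rel (associated_graph f B)"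
    using assms(3,4) by (intro edge_in_connection_rel) (auto simp: fst_associated_graph)
  then show ?thesis
    using in_quotient_imp_closed[OF equiv_classes assms(1)[unfolded classes_def] assms(2)] by simp
qed

text \<open>Each basis vector \<open>w\<close> occurring in the expansion of \<open>f b\<close> is
  the target of an edge from \<open>b\<close>, hence lies in the class of \<open>b\<close>.\<close>

lemma linear_image_span_class:
  assumes "is_basis B" and lin: "Vector_Spaces.linear scale scale f" and C: "C \<in> classes f B"
  shows "f ` span C \<subseteq> span C"
proof -
  interpret f: Vector_Spaces.linear scale scale f by (rule lin)
  have "f b \<in> span C" if b: "b \<in> C" for b
  proof -
    have bB: "b \<in> B" using b C Union_classes by blast
    have "representation B (f b) w *s w \<in> span C" if "representation B (f b) w \<noteq> 0" for w
    proof -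
      have "w \<in> B" using that by (rule representation_ne_zero)
      then have "w \<in> C"
        using that bB by (intro edge_same_class[OF C b]) (auto simp: associated_graph_def)
      then show ?thesis by (intro span_scale span_base)
    qed
    then have "(\<Sum>w | representation B (f b) w \<noteq> 0. representation B (f b) w *s w) \<in> span C"
      by (intro span_sum) auto
    then show ?thesis
      using assms(1) by (simp add: sum_nonzero_representation_eq is_basis_def)
  qed
  then have "span (f ` C) \<subseteq> span C"
    by (intro span_minimal) auto
  then show ?thesis by (simp add: f.span_image)
qed

text \<open>Directness holds since the classes partition the basis. A non-zero pairing between basis
  vectors of distinct classes would be an edge joining disjoint classes.\<close>

lemma orthogonal_direct_sum_classes:
  assumes "is_basis B"
  shows "orthogonal_direct_sum (classes f B) span"
  unfolding orthogonal_direct_sum_def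
proof (intro conjI ballI impI)
  show "direct_sum (classes f B) span"
    by (rule direct_sum_basis_partition[OF assms Union_classes disjoint_classes])
  fix C D u w
  assume C: "C \<in> classes f B" and D: "D \<in> classes f B" and ne: "C \<noteq> D"
    and "u \<in> span C" "w \<in> span D"
  moreover have "form c d = 0" if c: "c \<in> C" and d: "d \<in> D" for c d
  proof (rule ccontr)
    assume "form c d \<noteq> 0"
    then have "(c, d) \<in> snd (associated_graph f B)"
      using c d C D Union_classes[of f B] by (auto simp: associated_graph_def)
    moreover have "d \<in> B"
      using d D Union_classes by blast
    ultimately have "d \<in> C"
      using edge_same_class[OF C c] by blast
    then show False
      using C D ne d disjoint_classes[of f B] by (auto simp: disjoint_def)
  qed
  ultimately show "form u w = 0"
    by (blast intro: form_span_eq_0)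
qed

section \<open>Class operators and the splitting of the linear map\<close>

lemma is_class_operator_iff:
  assumes basis: "is_basis B" and lin: "Vector_Spaces.linear scale scale f"
    and C: "C \<in> classes f B"
  shows "is_class_operator f B C g \<longleftrightarrow> g = f \<circ> basis_projection B C"
proof
  interpret f: Vector_Spaces.linear scale scale f by (rule lin)
  have sub: "D \<subseteq> B" if "D \<in> classes f B" for D
    using that Union_classes by blast
  have lin': "Vector_Spaces.linear scale scale (f \<circ> basis_projection B C)"
    using linear_basis_projection[OF basis] lin by (rule Vector_Spaces.linear_compose)
  {
    assume g: "is_class_operator f B C g"
    \<comment> \<open>The classes cover \<open>B\<close>, so the conditions on a class operator fix
      its value at every basis vector: \<open>f b\<close> for \<open>b\<close> in \<open>C\<close>,
      and 0 otherwise.\<close>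
    show "g = f \<circ> basis_projection B C"
    proof (rule basis_linear_eq[OF basis _ lin'])
      show "Vector_Spaces.linear scale scale g"
        using g by (simp add: is_class_operator_def)
      fix b assume b: "b \<in> B"
      then obtain D where D: "D \<in> classes f B" "b \<in> D"
        using Union_classes by blast
      show "g b = (f \<circ> basis_projection B C) b"
      proof (cases "D = C")
        case True
        then show ?thesis
          using g D b by (simp add: is_class_operator_def basis_projection_basis[OF basis] span_base)
      next
        case False
        then have "g b = 0"
          using g D span_base[OF D(2)] unfolding is_class_operator_def by blast
        moreover have "b \<notin> C"
          using False D C disjoint_classes[of f B] by (auto simp: disjoint_def)
        ultimately show ?thesis
          using b by (simp add: basis_projection_basis[OF basis])
      qed
    qed
  }
  assume g: "g = f \<circ> basis_projection B C"
  have on: "g x = f x" if "x \<in> span C" for x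
    using basis_projection_ident[OF basis sub[OF C] that] by (simp add: g)
  have off: "g ` span D = {0}" if D: "D \<in> classes f B" "D \<noteq> C" for D
  proof -
    have "C \<inter> D = {}"
      using D C disjoint_classes[of f B] by (auto simp: disjoint_def)
    then have "g x = 0" if "x \<in> span D" for x
      using basis_projection_eq_0[OF basis sub[OF D(1)] _ that] by (simp add: g)
    \<comment> \<open>Equality with \<open>{0}\<close>, not just inclusion, needs the span to be
      non-empty; it contains 0.\<close>
    then show ?thesis
      using span_zero[of D] by force
  qed
  have "g ` span C \<subseteq> span C"
    using on linear_image_span_class[OF basis lin C] by auto
  then show "is_class_operator f B C g"
    using lin' on off unfolding is_class_operator_def by (simp add: g)
qed

lemma operator_splits_basis:
  assumes basis: "is_basis B" and lin: "Vector_Spaces.linear scale scale f"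
  shows "operator_splits f B"
proof -
  interpret f: Vector_Spaces.linear scale scale f by (rule lin)
  note iff = is_class_operator_iff[OF basis lin]
  \<comment> \<open>The equivalence \<open>iff\<close> gives existence and uniqueness at once, so
    the definite description evaluates.\<close>
  have op: "class_operator f B C = f \<circ> basis_projection B C" if "C \<in> classes f B" for C
    unfolding class_operator_def iff[OF that] by simp
  show ?thesis
    unfolding operator_splits_def
  proof (intro conjI ballI allI)
    show "\<exists>!g. is_class_operator f B C g" if "C \<in> classes f B" for C
      by (simp add: iff[OF that])
    fix x
    let ?N = "{C \<in> classes f B. basis_projection B C x \<noteq> 0}"
    have proj: "finite ?N" "(\<Sum>C\<in>?N. basis_projection B C x) = x"
      by (rule sum_basis_projections[OF basis Union_classes disjoint_classes])+
    \<comment> \<open>The inclusion may be strict, since \<open>f\<close> can annihilate a non-zero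
      projection of \<open>x\<close>. The additional summands over \<open>?N\<close> are
      zero.\<close>
    have sub: "{C \<in> classes f B. class_operator f B C x \<noteq> 0} \<subseteq> ?N"
      by (auto simp: op)
    then show "finite {C \<in> classes f B. class_operator f B C x \<noteq> 0}"
      using proj(1) finite_subset by blast
    have "f x = (\<Sum>C\<in>?N. f (basis_projection B C x))"
      by (subst proj(2)[symmetric]) (rule f.sum)
    also have "\<dots> = (\<Sum>C\<in>?N. class_operator f B C x)"
      by (rule sum.cong) (auto simp: op)
    also have "\<dots> = (\<Sum>C | C \<in> classes f B \<and> class_operator f B C x \<noteq> 0. class_operator f B C x)"
      using proj(1) sub by (intro sum.mono_neutral_right) auto
    finally show "f x = (\<Sum>C | C \<in> classes f B \<and> class_operator f B C x \<noteq> 0. class_operator f B C x)" .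
  qed
qed

section \<open>Transport of coordinates, edges and classes along an automorphism\<close>

lemma representation_image_bij:
  assumes basis: "is_basis B" "is_basis (\<phi> ` B)"
    and lin: "Vector_Spaces.linear scale scale \<phi>" and bij: "bij \<phi>"
  shows "representation (\<phi> ` B) (\<phi> x) (\<phi> b) = representation B x b"
proof -
  interpret \<phi>: Vector_Spaces.linear scale scale \<phi> by (rule lin)
  have inj: "inj \<phi>" using bij by (rule bij_is_inj)
  let ?r = "representation B x"
  \<comment> \<open>The candidate coordinates of \<open>\<phi> x\<close> are those of
    \<open>x\<close> pulled back along \<open>inv \<phi>\<close>; uniqueness of coordinates
    identifies them with the representation.\<close>
  let ?g = "\<lambda>y. ?r (inv \<phi> y)"
  have supp: "{y. ?g y \<noteq> 0} = \<phi> ` {b. ?r b \<noteq> 0}"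
    using bij_image_Collect_eq[OF bij, of "\<lambda>b. ?r b \<noteq> 0"] by simp
  have "representation (\<phi> ` B) (\<phi> x) = ?g"
  proof (rule representation_eqI)
    show "independent (\<phi> ` B)" "\<phi> x \<in> span (\<phi> ` B)"
      using basis by (simp_all add: is_basis_def)
    show "y \<in> \<phi> ` B" if "?g y \<noteq> 0" for y
    proof -
      have "y \<in> \<phi> ` {b. ?r b \<noteq> 0}" using that supp by blast
      then show ?thesis using representation_ne_zero by blast
    qed
    show "finite {y. ?g y \<noteq> 0}"
      unfolding supp by (intro finite_imageI finite_representation)
    have "(\<Sum>y | ?g y \<noteq> 0. ?g y *s y) = (\<Sum>b | ?r b \<noteq> 0. ?r b *s \<phi> b)"
      unfolding supp by (subst sum.reindex) (auto intro: inj_on_subset[OF inj] simp: inv_f_f[OF inj])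
    also have "\<dots> = \<phi> (\<Sum>b | ?r b \<noteq> 0. ?r b *s b)"
      by (simp add: \<phi>.sum \<phi>.scale)
    also have "\<dots> = \<phi> x"
      using basis by (simp add: sum_nonzero_representation_eq is_basis_def)
    finally show "(\<Sum>y | ?g y \<noteq> 0. ?g y *s y) = \<phi> x" .
  qed
  then show ?thesis by (simp add: inv_f_f[OF inj])
qed

text \<open>The automorphism preserves the pairings in both orders. Since
  \<open>f (\<phi> v) = \<phi> (f v)\<close>, the coefficients of \<open>f\<close> agree by
  \<open>representation_image_bij\<close>.\<close>

lemma automorphism_edge_iff:
  assumes basis: "is_basis B" "is_basis (\<phi> ` B)"
    and aut: "automorphism \<phi>" and comm: "\<phi> \<circ> f = f \<circ> \<phi>"
  shows "(\<phi> v, \<phi> w) \<in> snd (associated_graph f (\<phi> ` B)) \<longleftrightarrow> (v, w) \<in> snd (associated_graph f B)"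
proof -
  have \<phi>: "Vector_Spaces.linear scale scale \<phi>" "bij \<phi>" "\<And>x y. form (\<phi> x) (\<phi> y) = form x y"
    using aut by (auto simp: automorphism_def)
  have "f (\<phi> v) = \<phi> (f v)"
    using comm by (metis comp_apply)
  then show ?thesis
    using representation_image_bij[OF basis \<phi>(1,2)] \<phi>(3)
    by (simp add: associated_graph_def inj_image_mem_iff[OF bij_is_inj[OF \<phi>(2)]])
qed

lemma f_equivalent_imp:
  assumes lin: "Vector_Spaces.linear scale scale f" and basis: "is_basis B" "is_basis B'"
    and equiv: "f_equivalent f B B'"
  shows "graph_isomorphic (associated_graph f B) (associated_graph f B')"
    and "induced_decompositions_equivalent f B B'"
proof -
  obtain \<phi> where \<phi>: "automorphism \<phi>" "\<phi> ` B = B'" "\<phi> \<circ> f = f \<circ> \<phi>"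
    using equiv by (auto simp: f_equivalent_def)
  then interpret \<phi>: Vector_Spaces.linear scale scale \<phi>
    by (simp add: automorphism_def)
  have edge: "(v, w) \<in> snd (associated_graph f B) \<longleftrightarrow>
      (\<phi> v, \<phi> w) \<in> snd (associated_graph f B')" for v w
    using automorphism_edge_iff[OF basis(1) _ \<phi>(1,3)] basis(2) \<phi>(2) by simp
  have bij: "bij_betw \<phi> (fst (associated_graph f B)) (fst (associated_graph f B'))"
    using \<phi>(1,2) by (auto simp: fst_associated_graph automorphism_def bij_betw_def inj_on_def)
  show "graph_isomorphic (associated_graph f B) (associated_graph f B')"
    using bij edge by (auto simp: graph_isomorphic_def)
  \<comment> \<open>Taking images under \<open>\<phi>\<close> is the witness for the bijection of
    index sets; by linearity it matches the spans of corresponding classes.\<close>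
  have "bij_betw ((`) \<phi>) (classes f B) (classes f B')"
    using bij_betw_connection_classes[OF bij edge] by (simp add: classes_def fst_associated_graph)
  moreover have "\<phi> ` span C = span (\<phi> ` C)" for C
    by (simp add: \<phi>.span_image)
  ultimately have "equivalent_decompositions (classes f B) span (classes f B') span"
    using orthogonal_direct_sum_classes basis \<phi>(1)
    unfolding equivalent_decompositions_def by blast
  then show "induced_decompositions_equivalent f B B'"
    using operator_splits_basis basis lin by (simp add: induced_decompositions_equivalent_def)
qed

end

theorem theorem4p1:
  fixes scale :: "'a::field \<Rightarrow> 'b::ab_group_add \<Rightarrow> 'b"
    and form :: "'b \<Rightarrow> 'b \<Rightarrow> 'a"
    and f :: "'b \<Rightarrow> 'b"
    and B B' :: "'b set"
  assumes "pre_euclidean_space scale form"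
    and "Vector_Spaces.linear scale scale f"
    and "pre_euclidean_space.is_basis scale B"
    and "pre_euclidean_space.is_basis scale B'"
    and "pre_euclidean_space.f_equivalent scale form f B B'"
  shows "graph_isomorphic (pre_euclidean_space.associated_graph scale form f B)
           (pre_euclidean_space.associated_graph scale form f B')
    \<and> pre_euclidean_space.induced_decompositions_equivalent scale form f B B'"
  using pre_euclidean_space.f_equivalent_imp[OF assms] by blast

end
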